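(* Let $X$ be a non-empty set, $f:X\to X$ a self-map, equip $X$ with the primal topology $\tau_f$ induced by $f$, and let $C$ be a connected component of $X$. Then: (i) $\mathrm{Prox}(\mathcal{U}_f,f)=\triangleleft$ (as subsets of $X^2$). (ii) $\triangleleft|_C=\ \sim|_C\ = C\times C$ if and only if there is a periodic orbit of $f$ in $C$.
   Context: $\mathbb{N}$ is the set of non-negative integers. The primal topology induced by $f$ on $X$ is $\tau_f=\{A\subseteq X: f^{-1}(A)\subseteq A\}$; it is closed under arbitrary intersections, and the smallest open set containing $x$ is $V(x)=\{y\in X:\exists k\in\mathbb{N},\ f^k(y)=x\}$. $\mathcal{U}_f$ is the quasi-uniformity on $X$ consisting of all $U\subseteq X^2$ that contain $\{(x,y)\in X^2: y\in V(x)\}$; it induces $\tau_f$. $\mathrm{Prox}(\mathcal{U}_f,f)$ is the set of proximal pairs, i.e. of $(x,y)\in X^2$ such that $\{k\in\mathbb{N}:(f^k(x),f^k(y))\in U\}$ is infinite for every $U\in\mathcal{U}_f$. The relation $\triangleleft$ on $X$ is defined by: $x\triangleleft y$ if there are $m,n\in\mathbb{N}$ such that $f^m(x)=f^n(y)$ and $m\le n$. The equivalence relation $\sim$ on $X$ is defined by: $x\sim y$ if there are $m,n\in\mathbb{N}$ with $f^m(x)=f^n(y)$; its equivalence classes are the connected components of $(X,\tau_f)$. For a relation $\rho$ on $X$, $\rho|_C=\rho\cap(C\times C)$. A periodic orbit is a set $\{f^k(x):k\in\mathbb{N}\}$ with $f^k(x)=x$ for some positive integer $k$. *)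

theory Defs
  imports "HOL-Analysis.Analysis"
begin

definition primal_topology :: "'a set \<Rightarrow> ('a \<Rightarrow> 'a) \<Rightarrow> 'a topology" where
  "primal_topology X f = topology (\<lambda>A. A \<subseteq> X \<and> f -` A \<inter> X \<subseteq> A)"

lemma istopology_primal: "istopology (\<lambda>A. A \<subseteq> X \<and> f -` A \<inter> X \<subseteq> A)"
  unfolding istopology_def by blast

lemma openin_primal_topology:
  "openin (primal_topology X f) A \<longleftrightarrow> A \<subseteq> X \<and> f -` A \<inter> X \<subseteq> A"
  by (simp add: primal_topology_def topology_inverse' [OF istopology_primal])

lemma topspace_primal_topology [simp]:
  "topspace (primal_topology X f) = X"
  unfolding topspace_def openin_primal_topology by blast

definition min_nbhd :: "'a set \<Rightarrow> ('a \<Rightarrow> 'a) \<Rightarrow> 'a \<Rightarrow> 'a set" where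
  "min_nbhd X f x = {y \<in> X. \<exists>k. (f ^^ k) y = x}"

lemma funpow_closed: "f \<in> X \<rightarrow> X \<Longrightarrow> x \<in> X \<Longrightarrow> (f ^^ k) x \<in> X"
  by (induction k) auto

lemma min_nbhd_is_smallest_open:
  assumes "f \<in> X \<rightarrow> X" and "x \<in> X"
  shows "openin (primal_topology X f) (min_nbhd X f x)"
    and "x \<in> min_nbhd X f x"
    and "openin (primal_topology X f) A \<Longrightarrow> x \<in> A \<Longrightarrow> min_nbhd X f x \<subseteq> A"
proof -
  show "openin (primal_topology X f) (min_nbhd X f x)"
    unfolding openin_primal_topology min_nbhd_def
    by (auto simp del: funpow.simps) (metis comp_apply funpow_Suc_right)
  show "x \<in> min_nbhd X f x"
    using assms by (auto simp: min_nbhd_def intro: exI [of _ 0])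
  assume A: "openin (primal_topology X f) A" "x \<in> A"
  have "y \<in> X \<Longrightarrow> (f ^^ k) y \<in> A \<Longrightarrow> y \<in> A" for k y
  proof (induction k arbitrary: y)
    case (Suc k)
    then have "f y \<in> A"
      using assms(1) by (auto simp add: funpow_swap1)
    then show ?case
      using A Suc.prems(1) by (auto simp: openin_primal_topology)
  qed simp
  then show "min_nbhd X f x \<subseteq> A"
    using A by (auto simp: min_nbhd_def)
qed

definition primal_quasi_uniformity :: "'a set \<Rightarrow> ('a \<Rightarrow> 'a) \<Rightarrow> ('a \<times> 'a) set set" where
  "primal_quasi_uniformity X f =
     {U. U \<subseteq> X \<times> X \<and> {(x, y) \<in> X \<times> X. y \<in> min_nbhd X f x} \<subseteq> U}"

definition proximal_pairs ::
  "'a set \<Rightarrow> ('a \<times> 'a) set set \<Rightarrow> ('a \<Rightarrow> 'a) \<Rightarrow> ('a \<times> 'a) set" where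
  "proximal_pairs X \<U> f =
     {(x, y) \<in> X \<times> X. \<forall>U\<in>\<U>. infinite {k. ((f ^^ k) x, (f ^^ k) y) \<in> U}}"

definition orbit_le :: "'a set \<Rightarrow> ('a \<Rightarrow> 'a) \<Rightarrow> ('a \<times> 'a) set" where
  "orbit_le X f = {(x, y) \<in> X \<times> X. \<exists>m n. (f ^^ m) x = (f ^^ n) y \<and> m \<le> n}"

definition orbit_equiv :: "'a set \<Rightarrow> ('a \<Rightarrow> 'a) \<Rightarrow> ('a \<times> 'a) set" where
  "orbit_equiv X f = {(x, y) \<in> X \<times> X. \<exists>m n. (f ^^ m) x = (f ^^ n) y}"

definition periodic_orbits :: "'a set \<Rightarrow> ('a \<Rightarrow> 'a) \<Rightarrow> 'a set set" where
  "periodic_orbits X f =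
     {{(f ^^ k) x |k. True} |x. x \<in> X \<and> (\<exists>k>0. (f ^^ k) x = x)}"

end

theory Submission
  imports Defs
begin

text \<open>
  The smallest entourage consists of the pairs \<open>(x, y)\<close> with \<open>f\<^sup>j y = x\<close> for some \<open>j\<close>, so \<open>(x, y)\<close>
  is proximal iff \<open>f\<^sup>k x = f\<^bsup>k+j\<^esup> y\<close> for infinitely many \<open>k\<close>. An equation \<open>f\<^sup>m x = f\<^sup>n y\<close> with
  \<open>m \<le> n\<close> is inherited by all later times, which gives (i).

  For (ii), the components are the classes of \<open>\<sim>\<close>: a class is clopen, and it is
  connected because membership in either part of an open partition is invariant under \<open>f\<close>.
  If \<open>x \<triangleleft> f x\<close> then the orbit of \<open>x\<close> runs into a cycle. Conversely, if there is a
  cycle in \<open>C\<close>, all orbits in \<open>C\<close> run into it, and an equation \<open>f\<^sup>a x = f\<^sup>b y\<close> with value on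
  the cycle survives enlarging \<open>b\<close> by multiples of the period.
\<close>

lemma funpow_eq_add:
  fixes f :: "'a \<Rightarrow> 'a"
  shows "(f ^^ m) x = (f ^^ n) y \<Longrightarrow> (f ^^ (i + m)) x = (f ^^ (i + n)) y"
  by (simp add: funpow_add)

lemma funpow_mult_fixpoint:
  fixes f :: "'a \<Rightarrow> 'a"
  shows "(f ^^ k) x = x \<Longrightarrow> (f ^^ (j * k)) x = x"
  by (induction j) (simp_all add: funpow_add)

lemma equiv_orbit_equiv: "equiv X (orbit_equiv X f)"
proof (rule equivI)
  show "orbit_equiv X f \<subseteq> X \<times> X"
    by (auto simp: orbit_equiv_def)
  show "refl_on X (orbit_equiv X f)"
    by (auto simp: refl_on_def orbit_equiv_def)
  show "sym (orbit_equiv X f)"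
    by (auto simp: sym_def orbit_equiv_def) metis
  show "trans (orbit_equiv X f)"
  proof (rule transI)
    fix x y z assume "(x, y) \<in> orbit_equiv X f" "(y, z) \<in> orbit_equiv X f"
    then obtain m n p q where X: "x \<in> X" "z \<in> X"
      and "(f ^^ m) x = (f ^^ n) y" "(f ^^ p) y = (f ^^ q) z"
      by (auto simp: orbit_equiv_def)
    \<comment> \<open>Iterating the two equations \<open>p\<close> and \<open>n\<close> more times
      makes both pass through \<open>(f ^^ (p + n)) y\<close>.\<close>
    then have "(f ^^ (p + m)) x = (f ^^ (n + q)) z"
      by (metis add.commute funpow_eq_add)
    with X show "(x, z) \<in> orbit_equiv X f"
      by (auto simp: orbit_equiv_def)
  qed
qed

lemma orbit_equiv_funpow:
  assumes "f \<in> X \<rightarrow> X" "x \<in> X"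
  shows "(x, (f ^^ k) x) \<in> orbit_equiv X f"
proof -
  have "(f ^^ k) x = (f ^^ 0) ((f ^^ k) x)"
    by simp
  then show ?thesis
    using assms(2) funpow_closed[OF assms] unfolding orbit_equiv_def by blast
qed

text \<open>A point is equivalent to its image, so saturated sets contain their preimages. Applied
  to a class and to its complement, this makes classes clopen.\<close>

lemma openin_orbit_equiv_saturated:
  assumes "f \<in> X \<rightarrow> X" "A \<subseteq> X" "\<And>y z. (y, z) \<in> orbit_equiv X f \<Longrightarrow> z \<in> A \<Longrightarrow> y \<in> A"
  shows "openin (primal_topology X f) A"
proof -
  have "x \<in> A" if "x \<in> X" "f x \<in> A" for x
    using assms(3) that orbit_equiv_funpow[OF assms(1) that(1), of 1] by simp
  with assms(2) show ?thesis
    by (auto simp: openin_primal_topology)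
qed

lemma openin_orbit_equiv_class:
  assumes "f \<in> X \<rightarrow> X"
  shows "openin (primal_topology X f) (orbit_equiv X f `` {x})"
proof (rule openin_orbit_equiv_saturated[OF assms])
  show "orbit_equiv X f `` {x} \<subseteq> X"
    by (auto simp: orbit_equiv_def)
qed (use equiv_orbit_equiv[of X f] in \<open>auto elim!: equivE dest: symD transD\<close>)

text \<open>Membership in \<open>A\<close> is constant along each orbit in the class, and any two
  orbits in the class meet.\<close>

lemma orbit_equiv_class_subset_open_part:
  assumes f: "f \<in> X \<rightarrow> X"
    and A: "openin (primal_topology X f) A" and B: "openin (primal_topology X f) B"
    and cover: "orbit_equiv X f `` {x} \<subseteq> A \<union> B" and disj: "A \<inter> B = {}"
    and zA: "(x, z) \<in> orbit_equiv X f" "z \<in> A"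
  shows "orbit_equiv X f `` {x} \<subseteq> A"
proof -
  note E = equiv_orbit_equiv[of X f]
  have invariant: "(f ^^ k) w \<in> A \<longleftrightarrow> w \<in> A" if "(x, w) \<in> orbit_equiv X f" for w k
  proof (induction k)
    case (Suc k)
    have "w \<in> X"
      using that by (auto simp: orbit_equiv_def)
    then have "(x, (f ^^ i) w) \<in> orbit_equiv X f" for i
      using that orbit_equiv_funpow[OF f] E by (meson equivE transE)
    then have "(f ^^ k) w \<in> A \<union> B" "(f ^^ Suc k) w \<in> A \<union> B"
      using cover by blast+
    \<comment> \<open>Openness of \<open>A\<close> gives one direction. For the other, an image
      outside \<open>A\<close> lies in \<open>B\<close>, and openness of \<open>B\<close> pulls the
      point itself into \<open>B\<close>.\<close>
    then have "f ((f ^^ k) w) \<in> A \<longleftrightarrow> (f ^^ k) w \<in> A"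
      using A B disj by (auto simp: openin_primal_topology)
    with Suc show ?case
      by simp
  qed simp
  show ?thesis
  proof
    fix w assume "w \<in> orbit_equiv X f `` {x}"
    then have w: "(x, w) \<in> orbit_equiv X f"
      by simp
    then have "(z, w) \<in> orbit_equiv X f"
      using zA E by (meson equivE symE transE)
    then obtain m n where "(f ^^ m) z = (f ^^ n) w"
      by (auto simp: orbit_equiv_def)
    then show "w \<in> A"
      using invariant[OF w, of n] invariant[OF zA(1), of m] zA(2) by simp
  qed
qed

lemma connectedin_orbit_equiv_class:
  assumes "f \<in> X \<rightarrow> X"
  shows "connectedin (primal_topology X f) (orbit_equiv X f `` {x})"
proof -
  let ?T = "primal_topology X f" and ?E = "orbit_equiv X f `` {x}"
  have sub: "?E \<subseteq> X"
    by (auto simp: orbit_equiv_def)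
  note E = openin_orbit_equiv_class[OF assms, of x]
  have False
    if A: "openin ?T A" and B: "openin ?T B" and "?E \<subseteq> A \<union> B"
      "A \<inter> B \<inter> ?E = {}" "A \<inter> ?E \<noteq> {}" "B \<inter> ?E \<noteq> {}" for A B
  proof -
    \<comment> \<open>\<open>A\<close> and \<open>B\<close> are disjoint only within the class;
      their traces are disjoint outright, and still open because the class is open.\<close>
    have AE: "openin ?T (A \<inter> ?E)" "openin ?T (B \<inter> ?E)"
      using A B E by blast+
    then have "?E \<subseteq> A \<inter> ?E"
      using that orbit_equiv_class_subset_open_part[OF assms AE, of x] by blast
    then show False
      using that by blast
  qed
  then show ?thesis
    using sub unfolding connectedin by auto
qed

text \<open>The class is connected, so it lies in the component it meets; it is clopen, so it
  contains every connected set it meets.\<close>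

lemma connected_component_eq_orbit_equiv_class:
  assumes f: "f \<in> X \<rightarrow> X" and C: "C \<in> connected_components_of (primal_topology X f)"
    and x: "x \<in> C"
  shows "C = orbit_equiv X f `` {x}"
proof
  let ?T = "primal_topology X f" and ?E = "orbit_equiv X f `` {x}"
  note eqv = equiv_orbit_equiv[of X f]
  have "x \<in> X"
    using connected_components_of_subset[OF C] x by auto
  then have xE: "x \<in> ?E"
    using equiv_class_self[OF eqv] by blast
  show "?E \<subseteq> C"
    using connected_components_of_maximal[OF C connectedin_orbit_equiv_class[OF f]] xE x
    by (auto simp: disjnt_def)
  have sub: "?E \<subseteq> X"
    by (auto simp: orbit_equiv_def)
  note openin_orbit_equiv_class[OF f, of x]
  moreover have "openin ?T (X - ?E)"
    using eqv
    by (intro openin_orbit_equiv_saturated[OF f])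
       (auto elim!: equivE dest: transD simp: orbit_equiv_def)
  ultimately show "C \<subseteq> ?E"
    using connectedin_clopen_cases[OF connectedin_connected_components_of[OF C], of ?E] sub xE x
    by (auto simp: closedin_def disjnt_def)
qed

lemma proximal_pairs_primal_eq_orbit_le:
  assumes f: "f \<in> X \<rightarrow> X"
  shows "proximal_pairs X (primal_quasi_uniformity X f) f = orbit_le X f"
proof (intro equalityI subrelI)
  fix x y assume prox: "(x, y) \<in> proximal_pairs X (primal_quasi_uniformity X f) f"
  \<comment> \<open>Testing proximality on the smallest entourage, at a single time
    \<open>k\<close>, already yields the equation.\<close>
  let ?U = "{(x, y) \<in> X \<times> X. y \<in> min_nbhd X f x}"
  have "?U \<in> primal_quasi_uniformity X f"
    by (auto simp: primal_quasi_uniformity_def)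
  then have "infinite {k. ((f ^^ k) x, (f ^^ k) y) \<in> ?U}"
    using prox by (auto simp: proximal_pairs_def)
  then obtain k where "((f ^^ k) x, (f ^^ k) y) \<in> ?U"
    using not_finite_existsD by blast
  then obtain j where "(f ^^ j) ((f ^^ k) y) = (f ^^ k) x"
    by (auto simp: min_nbhd_def)
  then have "(f ^^ k) x = (f ^^ (j + k)) y"
    by (simp add: funpow_add)
  moreover have "k \<le> j + k"
    by simp
  ultimately show "(x, y) \<in> orbit_le X f"
    using prox unfolding proximal_pairs_def orbit_le_def by blast
next
  fix x y assume "(x, y) \<in> orbit_le X f"
  then obtain m n where xy: "x \<in> X" "y \<in> X" and mn: "(f ^^ m) x = (f ^^ n) y" "m \<le> n"
    by (auto simp: orbit_le_def)
  have "{m..} \<subseteq> {k. ((f ^^ k) x, (f ^^ k) y) \<in> U}"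
    if U: "U \<in> primal_quasi_uniformity X f" for U
  proof
    fix k assume "k \<in> {m..}"
    then have "(f ^^ k) x = (f ^^ (k - m + n)) y"
      using funpow_eq_add[OF mn(1), of "k - m"] by simp
    \<comment> \<open>Here \<open>m \<le> n\<close> enters: \<open>n - m\<close> is the fixed number
      of steps by which \<open>y\<close> lags behind \<open>x\<close> at every time
      \<open>k \<ge> m\<close>.\<close>
    also have "k - m + n = (n - m) + k"
      using \<open>k \<in> {m..}\<close> mn(2) by simp
    finally have "(f ^^ (n - m)) ((f ^^ k) y) = (f ^^ k) x"
      by (simp add: funpow_add)
    then have "(f ^^ k) y \<in> min_nbhd X f ((f ^^ k) x)"
      using funpow_closed[OF f xy(2)] by (auto simp: min_nbhd_def)
    then show "k \<in> {k. ((f ^^ k) x, (f ^^ k) y) \<in> U}"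
      using U funpow_closed[OF f] xy by (auto simp: primal_quasi_uniformity_def)
  qed
  then have "infinite {k. ((f ^^ k) x, (f ^^ k) y) \<in> U}"
    if "U \<in> primal_quasi_uniformity X f" for U
    using that infinite_super infinite_Ici by blast
  then show "(x, y) \<in> proximal_pairs X (primal_quasi_uniformity X f) f"
    using xy by (auto simp: proximal_pairs_def)
qed

text \<open>The extra application of \<open>f\<close> makes \<open>Suc n - m\<close> positive even
  when \<open>m = n\<close>, so it is a period of \<open>(f ^^ m) x\<close>.\<close>

lemma orbit_le_self_image_imp_periodic:
  assumes "(x, f x) \<in> orbit_le X f"
  shows "\<exists>m k. k > 0 \<and> (f ^^ k) ((f ^^ m) x) = (f ^^ m) x"
proof -
  obtain m n where mn: "(f ^^ m) x = (f ^^ n) (f x)" "m \<le> n"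
    using assms by (auto simp: orbit_le_def)
  have "(f ^^ (Suc n - m)) ((f ^^ m) x) = (f ^^ (Suc n - m + m)) x"
    by (simp only: funpow_add comp_apply)
  also have "\<dots> = (f ^^ m) x"
    using mn by (simp add: funpow_swap1)
  finally show ?thesis
    using mn(2) by (intro exI[of _ m] exI[of _ "Suc n - m"]) simp
qed

lemma orbit_equiv_periodic_imp_orbit_le:
  assumes x: "(x, p) \<in> orbit_equiv X f" and y: "(y, p) \<in> orbit_equiv X f"
    and k: "k > 0" "(f ^^ k) p = p"
  shows "(x, y) \<in> orbit_le X f"
proof -
  obtain m n m' n' where X: "x \<in> X" "y \<in> X"
    and m: "(f ^^ m) x = (f ^^ n) p" and m': "(f ^^ m') y = (f ^^ n') p"
    using x y by (auto simp: orbit_equiv_def)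
  have "(f ^^ (n' + m)) x = (f ^^ (n' + n)) p"
    by (rule funpow_eq_add[OF m])
  \<comment> \<open>Inserting \<open>n' + m\<close> full periods changes nothing at
    \<open>p\<close>, but since \<open>k \<ge> 1\<close> it lifts the exponent of \<open>y\<close>
    to at least that of \<open>x\<close>.\<close>
  also have "\<dots> = (f ^^ (n' + n)) ((f ^^ ((n' + m) * k)) p)"
    by (simp add: funpow_mult_fixpoint[OF k(2)])
  also have "\<dots> = (f ^^ ((n' + m) * k + n + n')) p"
    by (metis add.commute add.left_commute comp_apply funpow_add)
  also have "\<dots> = (f ^^ ((n' + m) * k + n + m')) y"
    by (rule funpow_eq_add[OF m'[symmetric]])
  finally have "(f ^^ (n' + m)) x = (f ^^ ((n' + m) * k + n + m')) y" .
  moreover have "n' + m \<le> (n' + m) * k + n + m'"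
    using k(1) by (simp add: trans_le_add1)
  ultimately show ?thesis
    using X unfolding orbit_le_def by blast
qed

theorem theorem16:
  fixes X :: "'a set" and f :: "'a \<Rightarrow> 'a" and C :: "'a set"
  assumes "X \<noteq> {}"
    and "f \<in> X \<rightarrow> X"
    and "C \<in> connected_components_of (primal_topology X f)"
  shows "proximal_pairs X (primal_quasi_uniformity X f) f = orbit_le X f \<and>
         ((orbit_le X f \<inter> (C \<times> C) = orbit_equiv X f \<inter> (C \<times> C) \<and>
           orbit_equiv X f \<inter> (C \<times> C) = C \<times> C)
          \<longleftrightarrow> (\<exists>P \<in> periodic_orbits X f. P \<subseteq> C))"
proof (intro conjI iffI)
  note class_eq = connected_component_eq_orbit_equiv_class[OF assms(2,3)]
  have CX: "C \<subseteq> X"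
    using connected_components_of_subset[OF assms(3)] by simp
  have closed: "(f ^^ k) x \<in> C" if "x \<in> C" for x k
    using that class_eq[OF that] CX orbit_equiv_funpow[OF assms(2)] by blast
  have CC: "C \<times> C \<subseteq> orbit_equiv X f"
    using class_eq by blast
  show "proximal_pairs X (primal_quasi_uniformity X f) f = orbit_le X f"
    by (rule proximal_pairs_primal_eq_orbit_le[OF assms(2)])
  show "\<exists>P \<in> periodic_orbits X f. P \<subseteq> C"
    if total: "orbit_le X f \<inter> (C \<times> C) = orbit_equiv X f \<inter> (C \<times> C) \<and>
           orbit_equiv X f \<inter> (C \<times> C) = C \<times> C"
  proof -
    obtain x where x: "x \<in> C"
      using nonempty_connected_components_of[OF assms(3)] by blast
    \<comment> \<open>One pair from \<open>C \<times> C\<close> suffices: a point and its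
      image.\<close>
    then have "(x, f x) \<in> orbit_le X f"
      using total closed[OF x, of 1] by auto
    then obtain m k where "k > 0" "(f ^^ k) ((f ^^ m) x) = (f ^^ m) x"
      using orbit_le_self_image_imp_periodic by metis
    then have "{(f ^^ i) ((f ^^ m) x) |i. True} \<in> periodic_orbits X f"
      using closed[OF x, of m] CX unfolding periodic_orbits_def by blast
    moreover have "{(f ^^ i) ((f ^^ m) x) |i. True} \<subseteq> C"
      using closed[OF closed[OF x]] by blast
    ultimately show ?thesis
      by blast
  qed
  assume "\<exists>P \<in> periodic_orbits X f. P \<subseteq> C"
  then obtain p k where k: "k > 0" "(f ^^ k) p = p" and orbit: "{(f ^^ i) p |i. True} \<subseteq> C"
    by (auto simp: periodic_orbits_def)
  have "(f ^^ 0) p \<in> C"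
    using orbit by blast
  then have "C \<times> C \<subseteq> orbit_le X f"
    using CC orbit_equiv_periodic_imp_orbit_le[OF _ _ k] by fastforce
  then show "orbit_le X f \<inter> (C \<times> C) = orbit_equiv X f \<inter> (C \<times> C)"
    and "orbit_equiv X f \<inter> (C \<times> C) = C \<times> C"
    using CC by auto
qed

end
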